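(* Let $M$ be a finite von Neumann algebra with a faithful normal trace. If $B$ is an atomic von Neumann subalgebra of $M$, then $$W^*(q\mathcal{N}^{(1)}_M(B))=q\mathcal{N}_M(B)''=M.$$
   Context: Inclusions of von Neumann algebras are unital. Since $B$ is a von Neumann subalgebra of a finite von Neumann algebra, atomic means that $B$ is a (finite or countably infinite) direct sum of full matrix algebras. An element $x\in M$ is a one sided quasi-normalizer of $B$ if there is a finite set $\{x_1,\dots,x_n\}\subseteq M$ with $Bx\subseteq\sum_{i=1}^n x_iB$; the set of these is $q\mathcal{N}^{(1)}_M(B)$, and $W^*(q\mathcal{N}^{(1)}_M(B))$ is the von Neumann subalgebra of $M$ generated by it. An element $x\in M$ is a quasi-normalizer of $B$ if there is a finite set $\{x_1,\dots,x_n\}\subseteq M$ with $Bx\subseteq\sum_{i=1}^n x_iB$ and $xB\subseteq\sum_{i=1}^n Bx_i$; the set of these is $q\mathcal{N}_M(B)$, and $q\mathcal{N}_M(B)''$ is the von Neumann algebra it generates. *)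

theory Defs
  imports
    "HOL-Analysis.Analysis"
    "HOL-Library.FuncSet"
    "Jordan_Normal_Form.Schur_Decomposition"
begin

section \<open>Complex Hilbert spaces\<close>

text \<open>The inner product is conjugate-linear in its first argument. Norm, metric and completeness
  come from the underlying real Hilbert space, whose inner product is the real part of
  the complex one.\<close>

class chilbert_space = real_inner + complete_space +
  fixes scaleC :: "complex \<Rightarrow> 'a \<Rightarrow> 'a" (infixr \<open>*\<^sub>C\<close> 75)
    and cinner :: "'a \<Rightarrow> 'a \<Rightarrow> complex"
  assumes scaleC_add_right: "c *\<^sub>C (x + y) = c *\<^sub>C x + c *\<^sub>C y"
    and scaleC_add_left: "(c + d) *\<^sub>C x = c *\<^sub>C x + d *\<^sub>C x"
    and scaleC_scaleC: "c *\<^sub>C d *\<^sub>C x = (c * d) *\<^sub>C x"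
    and scaleC_of_real: "complex_of_real r *\<^sub>C x = r *\<^sub>R x"
    and cinner_commute: "cinner x y = cnj (cinner y x)"
    and cinner_add_right: "cinner x (y + z) = cinner x y + cinner x z"
    and cinner_scaleC_right: "cinner x (c *\<^sub>C y) = c * cinner x y"
    and Re_cinner: "Re (cinner x y) = inner x y"

instantiation complex :: chilbert_space
begin

definition scaleC_complex :: "complex \<Rightarrow> complex \<Rightarrow> complex" where
  "scaleC_complex c x = c * x"

definition cinner_complex :: "complex \<Rightarrow> complex \<Rightarrow> complex" where
  "cinner_complex x y = cnj x * y"

instance
  by standard
    (auto simp: scaleC_complex_def cinner_complex_def algebra_simps complex_eq_iff inner_complex_def)

end

lemma norm_scaleC: "norm (c *\<^sub>C x) = cmod c * norm (x::'a::chilbert_space)"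
proof -
  have "cinner (c *\<^sub>C x) (c *\<^sub>C x) = c * cnj (c * cinner x x)"
    by (simp only: cinner_scaleC_right cinner_commute[of "c *\<^sub>C x" x])
  also have "\<dots> = complex_of_real ((cmod c)\<^sup>2) * cnj (cinner x x)"
    by (simp only: complex_cnj_mult mult.assoc[symmetric] complex_norm_square)
  finally have "Re (cinner (c *\<^sub>C x) (c *\<^sub>C x)) = (cmod c)\<^sup>2 * Re (cinner x x)"
    by simp
  then have "(norm (c *\<^sub>C x))\<^sup>2 = (cmod c * norm x)\<^sup>2"
    by (simp add: Re_cinner power2_norm_eq_inner power_mult_distrib)
  then show ?thesis
    by (simp add: power2_eq_iff_nonneg)
qed

lemma scaleC_scaleR: "c *\<^sub>C (r *\<^sub>R x) = r *\<^sub>R (c *\<^sub>C (x::'a::chilbert_space))"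
  by (simp only: scaleC_of_real[symmetric] scaleC_scaleC mult.commute)

lemma bounded_linear_scaleC: "bounded_linear (\<lambda>x::'a::chilbert_space. c *\<^sub>C x)"
  by (rule bounded_linear_intro[where K="cmod c"])
     (simp_all add: scaleC_add_right scaleC_scaleR norm_scaleC)

lemma Im_cinner: "Im (cinner x y) = - inner x (\<i> *\<^sub>C (y::'a::chilbert_space))"
  by (simp flip: Re_cinner add: cinner_scaleC_right)

text \<open>Riesz representation, needed for the existence of adjoints.\<close>

lemma riesz_representation:
  fixes f :: "'a::{real_inner,complete_space} \<Rightarrow> real"
  assumes "bounded_linear f"
  shows "\<exists>z. \<forall>x. f x = inner z x"
proof -
  interpret f: bounded_linear f by fact
  obtain K where K: "\<And>x. \<bar>f x\<bar> \<le> norm x * K"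
    using f.bounded by auto
  define J where "J x = (norm x)\<^sup>2 - 2 * f x" for x
  have J_ge: "- K\<^sup>2 \<le> J x" for x
  proof -
    have "0 \<le> (norm x - K)\<^sup>2" by simp
    also have "\<dots> = (norm x)\<^sup>2 - 2 * (norm x * K) + K\<^sup>2" by (simp add: power2_diff)
    also have "\<dots> \<le> J x + K\<^sup>2" using K[of x] by (auto simp: J_def abs_le_iff)
    finally show ?thesis by simp
  qed
  define m where "m = Inf (range J)"
  have bdd: "bdd_below (range J)" using J_ge by (auto intro!: bdd_belowI)
  have m_le: "m \<le> J x" for x unfolding m_def using bdd by (intro cInf_lower) auto
  have "\<exists>x. J x < m + 1 / real (Suc n)" for n
    using cInf_lessD[of "range J" "m + 1 / real (Suc n)"] by (auto simp: m_def)
  then obtain X where X: "\<And>n. J (X n) < m + 1 / real (Suc n)" by metis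
  have para: "(norm (x - y))\<^sup>2 = 2 * (J x + J y - 2 * J ((1/2) *\<^sub>R (x + y)))" for x y
    by (simp add: J_def f.scaleR f.add power2_norm_eq_inner inner_diff_left inner_diff_right
        inner_add_left inner_add_right inner_commute algebra_simps)
  have close: "(norm (X n - X k))\<^sup>2 \<le> 2 * (1 / real (Suc n) + 1 / real (Suc k))" for n k
    unfolding para using X[of n] X[of k] m_le[of "(1/2) *\<^sub>R (X n + X k)"]
    by (auto simp del: of_nat_Suc simp: algebra_simps)
  have "Cauchy X"
  proof (rule metric_CauchyI)
    fix e :: real assume e: "e > 0"
    obtain N where N: "1 / real (Suc N) < e\<^sup>2 / 4"
      using e reals_Archimedean[of "e\<^sup>2/4"] by (auto simp: inverse_eq_divide)
    show "\<exists>M. \<forall>m\<ge>M. \<forall>n\<ge>M. dist (X m) (X n) < e"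
    proof (intro exI allI impI)
      fix p q assume pq: "p \<ge> N" "q \<ge> N"
      have "1 / real (Suc p) \<le> 1 / real (Suc N)" "1 / real (Suc q) \<le> 1 / real (Suc N)"
        using pq by (auto intro!: divide_left_mono)
      then have "(norm (X p - X q))\<^sup>2 < e\<^sup>2"
        using N close[of p q] by argo
      then show "dist (X p) (X q) < e"
        using e by (metis dist_norm less_le power2_less_imp_less)
    qed
  qed
  then obtain z where z: "X \<longlonglongrightarrow> z"
    using Cauchy_convergent convergent_def by blast
  have "(\<lambda>n. J (X n)) \<longlonglongrightarrow> J z"
    unfolding J_def by (intro tendsto_intros z f.tendsto)
  moreover have "(\<lambda>n. m + 1 / real (Suc n)) \<longlonglongrightarrow> m + 0"
    by (intro tendsto_intros LIMSEQ_Suc[OF lim_1_over_n])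
  ultimately have Jz: "J z \<le> m"
    using X by (intro LIMSEQ_le) (auto intro!: less_imp_le)
  have "f h = inner z h" for h
  proof (rule ccontr)
    assume ne: "f h \<noteq> inner z h"
    then have h: "h \<noteq> 0" using f.zero by auto
    define a where "a = inner z h - f h"
    define t where "t = - a / (norm h)\<^sup>2"
    have "J (z + t *\<^sub>R h) = J z + 2 * t * a + t\<^sup>2 * (norm h)\<^sup>2"
      unfolding J_def a_def power2_norm_eq_inner power2_eq_square[of t]
      by (simp add: f.add f.scaleR inner_add_left inner_add_right inner_commute[of h z] algebra_simps)
    also have "2 * t * a + t\<^sup>2 * (norm h)\<^sup>2 = - (a\<^sup>2 / (norm h)\<^sup>2)"
      using h by (simp add: t_def field_simps power2_eq_square)
    then have "J z + 2 * t * a + t\<^sup>2 * (norm h)\<^sup>2 < J z"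
      using ne h by (simp add: a_def add.assoc)
    finally show False using m_le[of "z + t *\<^sub>R h"] Jz by linarith
  qed
  then show ?thesis by blast
qed


section \<open>Bounded operators\<close>

text \<open>A value of type \<open>'h \<Rightarrow>\<^sub>L 'h\<close> is a priori only real-linear; \<open>bounded_ops\<close> is the
  algebra of all bounded complex-linear operators.\<close>

definition bounded_ops :: "('h::chilbert_space \<Rightarrow>\<^sub>L 'h) set" where
  "bounded_ops = {T. \<forall>c x. blinfun_apply T (c *\<^sub>C x) = c *\<^sub>C blinfun_apply T x}"

definition scaleC_op :: "complex \<Rightarrow> ('h::chilbert_space \<Rightarrow>\<^sub>L 'h) \<Rightarrow> ('h \<Rightarrow>\<^sub>L 'h)" where
  "scaleC_op c T = Blinfun (\<lambda>x. c *\<^sub>C blinfun_apply T x)"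

definition adj :: "('h::chilbert_space \<Rightarrow>\<^sub>L 'h) \<Rightarrow> ('h \<Rightarrow>\<^sub>L 'h)" where
  "adj T = (THE S. \<forall>x y. cinner (blinfun_apply S x) y = cinner x (blinfun_apply T y))"

definition commutant :: "('h::chilbert_space \<Rightarrow>\<^sub>L 'h) set \<Rightarrow> ('h \<Rightarrow>\<^sub>L 'h) set" where
  "commutant S = {T \<in> bounded_ops. \<forall>A\<in>S. T o\<^sub>L A = A o\<^sub>L T}"

lemma scaleC_op_apply [simp]:
  "blinfun_apply (scaleC_op c T) x = c *\<^sub>C blinfun_apply T x"
  unfolding scaleC_op_def
  by (subst bounded_linear_Blinfun_apply)
     (auto intro: bounded_linear_compose[OF bounded_linear_scaleC blinfun.bounded_linear_right])

lemma cinner_ext: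
  assumes "\<And>y. cinner u y = cinner v (y::'a::chilbert_space)"
  shows "u = v"
proof -
  have "inner (u - v) y = 0" for y
    using arg_cong[OF assms[of y], of Re] by (simp add: Re_cinner inner_diff_left)
  then show ?thesis by (metis inner_eq_zero_iff right_minus_eq)
qed

lemma adj_unique:
  fixes T :: "'h::chilbert_space \<Rightarrow>\<^sub>L 'h"
  assumes "\<And>x y. cinner (blinfun_apply S x) y = cinner x (blinfun_apply T y)"
  shows "adj T = S"
  unfolding adj_def
proof (rule the_equality)
  fix S' assume S': "\<forall>x y. cinner (blinfun_apply S' x) y = cinner x (blinfun_apply T y)"
  show "S' = S" by (rule blinfun_eqI, rule cinner_ext) (simp add: S' assms)
qed (use assms in blast)

lemma cinner_adj:
  fixes T :: "'h::chilbert_space \<Rightarrow>\<^sub>L 'h"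
  assumes T: "T \<in> bounded_ops"
  shows "cinner (blinfun_apply (adj T) x) y = cinner x (blinfun_apply T y)"
proof -
  have "\<exists>z. \<forall>y. inner x (blinfun_apply T y) = inner z y" for x
    by (rule riesz_representation)
       (rule bounded_linear_compose[OF bounded_linear_inner_right blinfun.bounded_linear_right])
  then obtain s where s: "\<And>x y. inner x (blinfun_apply T y) = inner (s x) y" by metis
  have ext: "u = v" if "\<And>y. inner u y = inner v y" for u v :: 'h
    using that by (metis inner_diff_left inner_eq_zero_iff right_minus_eq)
  have bl: "bounded_linear s"
  proof (rule bounded_linear_intro[where K="norm T"])
    show "s (x + y) = s x + s y" for x y
      by (rule ext) (simp add: s[symmetric] inner_add_left)
    show "s (r *\<^sub>R x) = r *\<^sub>R s x" for r x
      by (rule ext) (simp add: s[symmetric])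
    show "norm (s x) \<le> norm x * norm T" for x
    proof -
      have "norm (s x) * norm (s x) = inner x (blinfun_apply T (s x))"
        by (simp add: s power2_norm_eq_inner[symmetric] power2_eq_square)
      also have "\<dots> \<le> norm x * norm (blinfun_apply T (s x))"
        by (rule norm_cauchy_schwarz)
      also have "\<dots> \<le> norm x * (norm T * norm (s x))"
        by (intro mult_left_mono norm_blinfun) auto
      finally have "norm (s x) * norm (s x) \<le> (norm x * norm T) * norm (s x)"
        by (simp add: mult.assoc)
      then show ?thesis
        by (cases "norm (s x) = 0") (auto simp: mult_le_cancel_right)
    qed
  qed
  have *: "cinner (s x) y = cinner x (blinfun_apply T y)" for x y
    using T by (simp add: complex_eq_iff Re_cinner Im_cinner bounded_ops_def flip: s)
  have "adj T = Blinfun s"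
    by (rule adj_unique) (simp add: bounded_linear_Blinfun_apply[OF bl] *)
  then show ?thesis by (simp add: bounded_linear_Blinfun_apply[OF bl] *)
qed

lemma cinner_adj':
  assumes "T \<in> bounded_ops"
  shows "cinner x (blinfun_apply (adj T) y) = cinner (blinfun_apply T x) y"
  by (metis assms cinner_adj cinner_commute)

lemma adj_bounded_ops:
  assumes T: "T \<in> bounded_ops"
  shows "adj T \<in> bounded_ops"
proof -
  have "blinfun_apply (adj T) (c *\<^sub>C x) = c *\<^sub>C blinfun_apply (adj T) x" for c x
  proof (rule cinner_ext)
    fix y
    show "cinner (blinfun_apply (adj T) (c *\<^sub>C x)) y = cinner (c *\<^sub>C blinfun_apply (adj T) x) y"
      by (metis T cinner_adj cinner_commute cinner_scaleC_right)
  qed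
  then show ?thesis by (simp add: bounded_ops_def)
qed

lemma adj_adj: "T \<in> bounded_ops \<Longrightarrow> adj (adj T) = T"
  by (rule adj_unique) (simp add: cinner_adj')

lemma adj_compose:
  assumes "S \<in> bounded_ops" "T \<in> bounded_ops"
  shows "adj (S o\<^sub>L T) = adj T o\<^sub>L adj S"
  by (rule adj_unique) (simp add: assms cinner_adj)


section \<open>Von Neumann algebras\<close>

text \<open>The bicommutant condition makes \<open>M\<close> a complex algebra containing the identity operator;
  in particular all inclusions of von Neumann algebras below are unital.\<close>

definition von_neumann_algebra :: "('h::chilbert_space \<Rightarrow>\<^sub>L 'h) set \<Rightarrow> bool" where
  "von_neumann_algebra M \<longleftrightarrow>
     M \<subseteq> bounded_ops \<and> (\<forall>T\<in>M. adj T \<in> M) \<and> commutant (commutant M) = M"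

definition vN_subalgebra ::
  "('h::chilbert_space \<Rightarrow>\<^sub>L 'h) set \<Rightarrow> ('h \<Rightarrow>\<^sub>L 'h) set \<Rightarrow> bool" where
  "vN_subalgebra B M \<longleftrightarrow> von_neumann_algebra B \<and> B \<subseteq> M"

definition vN_generated ::
  "('h::chilbert_space \<Rightarrow>\<^sub>L 'h) set \<Rightarrow> ('h \<Rightarrow>\<^sub>L 'h) set \<Rightarrow> ('h \<Rightarrow>\<^sub>L 'h) set" where
  "vN_generated M S = \<Inter>{N. vN_subalgebra N M \<and> S \<subseteq> N}"

text \<open>Every isometry in \<open>M\<close> is unitary.\<close>

definition finite_vN :: "('h::chilbert_space \<Rightarrow>\<^sub>L 'h) set \<Rightarrow> bool" where
  "finite_vN M \<longleftrightarrow> von_neumann_algebra M \<and>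
     (\<forall>V\<in>M. adj V o\<^sub>L V = id_blinfun \<longrightarrow> V o\<^sub>L adj V = id_blinfun)"

lemma commutant_antimono: "S \<subseteq> T \<Longrightarrow> commutant T \<subseteq> commutant S"
  by (auto simp: commutant_def)

lemma adj_commutant:
  assumes "S \<subseteq> bounded_ops" and "\<And>A. A \<in> S \<Longrightarrow> adj A \<in> S" and "T \<in> commutant S"
  shows "adj T \<in> commutant S"
proof -
  have T: "T \<in> bounded_ops" using assms(3) by (simp add: commutant_def)
  have "adj T o\<^sub>L A = A o\<^sub>L adj T" if A: "A \<in> S" for A
  proof -
    have "adj A \<in> bounded_ops" "adj (adj A) = A"
      using A assms(1) by (auto intro: adj_bounded_ops adj_adj)
    then show ?thesis
      using adj_compose[OF _ T, of "adj A"] adj_compose[OF T, of "adj A"] assms(2)[OF A] assms(3)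
      by (auto simp: commutant_def)
  qed
  then show ?thesis using T by (simp add: commutant_def adj_bounded_ops)
qed

text \<open>For self-adjoint sets the generated von Neumann algebra is the bicommutant.\<close>

lemma vN_generated_eq_bicommutant:
  assumes M: "von_neumann_algebra M" and "S \<subseteq> M" and adj: "\<And>A. A \<in> S \<Longrightarrow> adj A \<in> S"
  shows "vN_generated M S = commutant (commutant S)"
proof
  have S: "S \<subseteq> bounded_ops" using assms by (auto simp: von_neumann_algebra_def)
  have sub: "S \<subseteq> commutant (commutant S)" using S by (auto simp: commutant_def)
  have 1: "commutant S \<subseteq> bounded_ops" "commutant (commutant S) \<subseteq> bounded_ops"
    by (auto simp: commutant_def)
  have "\<And>T. T \<in> commutant (commutant S) \<Longrightarrow> adj T \<in> commutant (commutant S)"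
    by (rule adj_commutant[OF 1(1)]) (auto intro: adj_commutant[OF S adj])
  moreover have "commutant (commutant (commutant (commutant S))) = commutant (commutant S)"
    using sub commutant_antimono 1 by (auto simp: commutant_def)
  moreover have "commutant (commutant S) \<subseteq> M"
    using \<open>S \<subseteq> M\<close> M commutant_antimono unfolding von_neumann_algebra_def by metis
  ultimately have "vN_subalgebra (commutant (commutant S)) M"
    using 1 by (simp add: vN_subalgebra_def von_neumann_algebra_def)
  then show "vN_generated M S \<subseteq> commutant (commutant S)"
    using sub by (auto simp: vN_generated_def)
  show "commutant (commutant S) \<subseteq> vN_generated M S"
  proof -
    have "commutant (commutant S) \<subseteq> N" if "vN_subalgebra N M" "S \<subseteq> N" for N
      using that commutant_antimono unfolding vN_subalgebra_def von_neumann_algebra_def by metis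
    then show ?thesis by (auto simp: vN_generated_def)
  qed
qed


section \<open>Faithful normal traces\<close>

definition op_le :: "('h::chilbert_space \<Rightarrow>\<^sub>L 'h) \<Rightarrow> ('h \<Rightarrow>\<^sub>L 'h) \<Rightarrow> bool" where
  "op_le S T \<longleftrightarrow> (\<forall>x. Im (cinner x (blinfun_apply (T - S) x)) = 0
                   \<and> 0 \<le> Re (cinner x (blinfun_apply (T - S) x)))"

definition self_adjoint_part :: "('h::chilbert_space \<Rightarrow>\<^sub>L 'h) set \<Rightarrow> ('h \<Rightarrow>\<^sub>L 'h) set" where
  "self_adjoint_part M = {T \<in> M. adj T = T}"

definition op_directed :: "('h::chilbert_space \<Rightarrow>\<^sub>L 'h) set \<Rightarrow> bool" where
  "op_directed D \<longleftrightarrow> D \<noteq> {} \<and> (\<forall>S\<in>D. \<forall>T\<in>D. \<exists>U\<in>D. op_le S U \<and> op_le T U)"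

definition op_is_sup ::
  "('h::chilbert_space \<Rightarrow>\<^sub>L 'h) set \<Rightarrow> ('h \<Rightarrow>\<^sub>L 'h) set \<Rightarrow> ('h \<Rightarrow>\<^sub>L 'h) \<Rightarrow> bool" where
  "op_is_sup M D s \<longleftrightarrow> s \<in> self_adjoint_part M \<and> (\<forall>T\<in>D. op_le T s) \<and>
     (\<forall>u\<in>self_adjoint_part M. (\<forall>T\<in>D. op_le T u) \<longrightarrow> op_le s u)"

definition positive_functional ::
  "('h::chilbert_space \<Rightarrow>\<^sub>L 'h) set \<Rightarrow> (('h \<Rightarrow>\<^sub>L 'h) \<Rightarrow> complex) \<Rightarrow> bool" where
  "positive_functional M \<tau> \<longleftrightarrow>
     (\<forall>S\<in>M. \<forall>T\<in>M. \<tau> (S + T) = \<tau> S + \<tau> T) \<and>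
     (\<forall>c. \<forall>T\<in>M. \<tau> (scaleC_op c T) = c * \<tau> T) \<and>
     (\<forall>T\<in>M. Im (\<tau> (adj T o\<^sub>L T)) = 0 \<and> 0 \<le> Re (\<tau> (adj T o\<^sub>L T)))"

text \<open>A positive functional is real on self-adjoint elements, so passing to real parts in the
  last clause loses nothing. The trace is not assumed to be normalised.\<close>

definition faithful_normal_trace ::
  "('h::chilbert_space \<Rightarrow>\<^sub>L 'h) set \<Rightarrow> (('h \<Rightarrow>\<^sub>L 'h) \<Rightarrow> complex) \<Rightarrow> bool" where
  "faithful_normal_trace M \<tau> \<longleftrightarrow>
     positive_functional M \<tau> \<and>
     (\<forall>S\<in>M. \<forall>T\<in>M. \<tau> (S o\<^sub>L T) = \<tau> (T o\<^sub>L S)) \<and>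
     (\<forall>T\<in>M. \<tau> (adj T o\<^sub>L T) = 0 \<longrightarrow> T = 0) \<and>
     (\<forall>D s. D \<subseteq> self_adjoint_part M \<and> op_directed D \<and> op_is_sup M D s
        \<longrightarrow> Re (\<tau> s) = (SUP T\<in>D. Re (\<tau> T)))"


section \<open>Atomic algebras\<close>

text \<open>The direct sum of the matrix algebras of sizes \<open>n i\<close> (\<open>i \<in> I\<close>) in the sense of von
  Neumann algebras: all families that are bounded in operator norm.\<close>

definition matrix_direct_sum :: "nat set \<Rightarrow> (nat \<Rightarrow> nat) \<Rightarrow> (nat \<Rightarrow> complex mat) set" where
  "matrix_direct_sum I n =
     {A \<in> (\<Pi>\<^sub>E i\<in>I. carrier_mat (n i) (n i)).
        \<exists>C. \<forall>i\<in>I. \<forall>v\<in>carrier_vec (n i).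
          (\<Sum>k<n i. (cmod (vec_index (mult_mat_vec (A i) v) k))\<^sup>2)
            \<le> C * (\<Sum>k<n i. (cmod (vec_index v k))\<^sup>2)}"

definition matrix_star_isomorphism ::
  "('h::chilbert_space \<Rightarrow>\<^sub>L 'h) set \<Rightarrow> nat set \<Rightarrow> (nat \<Rightarrow> nat)
     \<Rightarrow> (('h \<Rightarrow>\<^sub>L 'h) \<Rightarrow> nat \<Rightarrow> complex mat) \<Rightarrow> bool" where
  "matrix_star_isomorphism B I n \<phi> \<longleftrightarrow>
     bij_betw \<phi> B (matrix_direct_sum I n) \<and>
     (\<forall>S\<in>B. \<forall>T\<in>B. \<forall>i\<in>I. \<phi> (S + T) i = \<phi> S i + \<phi> T i) \<and>
     (\<forall>c. \<forall>T\<in>B. \<forall>i\<in>I. \<phi> (scaleC_op c T) i = c \<cdot>\<^sub>m \<phi> T i) \<and>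
     (\<forall>S\<in>B. \<forall>T\<in>B. \<forall>i\<in>I. \<phi> (S o\<^sub>L T) i = \<phi> S i * \<phi> T i) \<and>
     (\<forall>T\<in>B. \<forall>i\<in>I. \<phi> (adj T) i = mat_adjoint (\<phi> T i))"

text \<open>The index set is an arbitrary, finite or infinite, set of natural numbers.\<close>

definition atomic_vN :: "('h::chilbert_space \<Rightarrow>\<^sub>L 'h) set \<Rightarrow> bool" where
  "atomic_vN B \<longleftrightarrow> von_neumann_algebra B \<and>
     (\<exists>(I :: nat set) n \<phi>. (\<forall>i\<in>I. 1 \<le> n i) \<and> matrix_star_isomorphism B I n \<phi>)"


section \<open>Quasi-normalizers\<close>

text \<open>For \<open>X = {x\<^sub>1, \<dots>, x\<^sub>n}\<close> these are the sums of the \<open>x\<^sub>i B\<close>, respectively of the \<open>B x\<^sub>i\<close>.\<close>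

definition right_module_sum ::
  "('h::chilbert_space \<Rightarrow>\<^sub>L 'h) set \<Rightarrow> ('h \<Rightarrow>\<^sub>L 'h) set \<Rightarrow> ('h \<Rightarrow>\<^sub>L 'h) set" where
  "right_module_sum X B = {\<Sum>y\<in>X. y o\<^sub>L f y | f. \<forall>y\<in>X. f y \<in> B}"

definition left_module_sum ::
  "('h::chilbert_space \<Rightarrow>\<^sub>L 'h) set \<Rightarrow> ('h \<Rightarrow>\<^sub>L 'h) set \<Rightarrow> ('h \<Rightarrow>\<^sub>L 'h) set" where
  "left_module_sum B X = {\<Sum>y\<in>X. f y o\<^sub>L y | f. \<forall>y\<in>X. f y \<in> B}"

definition one_sided_quasi_normalizers ::
  "('h::chilbert_space \<Rightarrow>\<^sub>L 'h) set \<Rightarrow> ('h \<Rightarrow>\<^sub>L 'h) set \<Rightarrow> ('h \<Rightarrow>\<^sub>L 'h) set" where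
  "one_sided_quasi_normalizers M B =
     {x \<in> M. \<exists>X. finite X \<and> X \<subseteq> M \<and> (\<lambda>b. b o\<^sub>L x) ` B \<subseteq> right_module_sum X B}"

definition quasi_normalizers ::
  "('h::chilbert_space \<Rightarrow>\<^sub>L 'h) set \<Rightarrow> ('h \<Rightarrow>\<^sub>L 'h) set \<Rightarrow> ('h \<Rightarrow>\<^sub>L 'h) set" where
  "quasi_normalizers M B =
     {x \<in> M. \<exists>X. finite X \<and> X \<subseteq> M \<and> (\<lambda>b. b o\<^sub>L x) ` B \<subseteq> right_module_sum X B
                                   \<and> (\<lambda>b. x o\<^sub>L b) ` B \<subseteq> left_module_sum B X}"

end

theory Submission
  imports Defs
begin

text \<open>Write \<open>B\<close> as a direct sum of full matrix algebras and let \<open>z\<^sub>i\<close> be the projection of \<open>B\<close> that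
  is the identity in the \<open>i\<close>-th summand and zero in the others. For \<open>x \<in> M\<close> the corner
  \<open>z\<^sub>i x z\<^sub>j\<close> is a quasi-normalizer: \<open>B z\<^sub>i\<close> and \<open>z\<^sub>j B\<close> are finite-dimensional, spanned by matrix
  units, so \<open>B z\<^sub>i x z\<^sub>j\<close> is spanned by the finitely many \<open>e x z\<^sub>j\<close> and \<open>z\<^sub>i x z\<^sub>j B\<close> by the finitely
  many \<open>z\<^sub>i x e\<close>, where \<open>e\<close> runs through the matrix units of the summand concerned
  (\<open>quasi_normalizer_corner\<close>).

  The \<open>z\<^sub>i\<close> sum strongly to the identity (\<open>partial_unit_tendsto\<close>). The isomorphism with the direct
  sum is only an algebraic one, so this does not follow by transporting a limit. Instead, the partial
  sums converge strongly because they are increasing projections; the limit lies in \<open>B\<close> because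
  \<open>B\<close> is a bicommutant, and it absorbs every \<open>z\<^sub>i\<close>. Hence all its components are identity matrices,
  and by injectivity of the isomorphism it is the identity operator.

  An operator that commutes with all corners of \<open>x\<close> therefore commutes with \<open>x\<close>
  (\<open>commutant_quasi_normalizers\<close>). So the quasi-normalizers have the same commutant as \<open>M\<close>, and
  their bicommutant is \<open>M\<close>. Every von Neumann algebra that contains the one-sided quasi-normalizers
  contains the quasi-normalizers, hence contains \<open>M\<close>.\<close>

section \<open>Closure properties of commutants\<close>

lemma commutant_id: "id_blinfun \<in> commutant S"
  by (auto simp: commutant_def bounded_ops_def intro!: blinfun_eqI)

lemma blinfun_compose_assoc: "(S o\<^sub>L T) o\<^sub>L U = S o\<^sub>L (T o\<^sub>L U)"
  by (rule blinfun_eqI) simp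

lemma scaleC_zero_right: "c *\<^sub>C (0::'a::chilbert_space) = 0"
  using scaleC_add_right[of c 0 "0::'a"] by simp

lemma commutant_comp: "T \<in> commutant S \<Longrightarrow> U \<in> commutant S \<Longrightarrow> T o\<^sub>L U \<in> commutant S"
  by (simp add: commutant_def bounded_ops_def blinfun_compose_assoc)
     (metis blinfun_compose_assoc)

lemma commutant_zero: "0 \<in> commutant S"
  by (auto simp: commutant_def bounded_ops_def blinfun.zero_left scaleC_zero_right
      intro!: blinfun_eqI)

lemma commutant_add: "T \<in> commutant S \<Longrightarrow> U \<in> commutant S \<Longrightarrow> T + U \<in> commutant S"
  by (simp add: commutant_def bounded_ops_def blinfun.add_left scaleC_add_right
      bounded_bilinear.add_left[OF bounded_bilinear_blinfun_compose]
      bounded_bilinear.add_right[OF bounded_bilinear_blinfun_compose])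

lemma commutant_sum: "(\<And>k. k \<in> K \<Longrightarrow> f k \<in> commutant S) \<Longrightarrow> (\<Sum>k\<in>K. f k) \<in> commutant S"
  by (induction K rule: infinite_finite_induct) (auto intro: commutant_zero commutant_add)

lemma commutant_scaleC:
  assumes "S \<subseteq> bounded_ops" "T \<in> commutant S"
  shows "scaleC_op c T \<in> commutant S"
proof -
  have "scaleC_op c T o\<^sub>L A = A o\<^sub>L scaleC_op c T" if A: "A \<in> S" for A
  proof (rule blinfun_eqI)
    fix \<xi>
    have "blinfun_apply (T o\<^sub>L A) \<xi> = blinfun_apply (A o\<^sub>L T) \<xi>"
      using assms(2) A by (simp add: commutant_def)
    then show "blinfun_apply (scaleC_op c T o\<^sub>L A) \<xi> = blinfun_apply (A o\<^sub>L scaleC_op c T) \<xi>"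
      using assms(1) A by (auto simp: bounded_ops_def)
  qed
  moreover have "scaleC_op c T \<in> bounded_ops"
    using assms(2) by (auto simp: commutant_def bounded_ops_def scaleC_scaleC mult.commute)
  ultimately show ?thesis by (simp add: commutant_def)
qed

text \<open>Commuting with an operator, and complex linearity, are pointwise identities between continuous
  expressions, so they survive pointwise limits; the uniform bound makes the limit bounded.\<close>

lemma commutant_strong_limit:
  fixes P :: "nat \<Rightarrow> 'h::chilbert_space \<Rightarrow>\<^sub>L 'h"
  assumes P: "\<And>n. P n \<in> commutant S"
    and bound: "\<And>n \<xi>. norm (blinfun_apply (P n) \<xi>) \<le> K * norm \<xi>"
    and conv: "\<And>\<xi>. convergent (\<lambda>n. blinfun_apply (P n) \<xi>)"
  obtains Q where "Q \<in> commutant S"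
    and "\<And>\<xi>. (\<lambda>n. blinfun_apply (P n) \<xi>) \<longlonglongrightarrow> blinfun_apply Q \<xi>"
proof -
  define q where "q \<xi> = lim (\<lambda>n. blinfun_apply (P n) \<xi>)" for \<xi>
  have q: "(\<lambda>n. blinfun_apply (P n) \<xi>) \<longlonglongrightarrow> q \<xi>" for \<xi>
    unfolding q_def using conv by (simp add: convergent_LIMSEQ_iff)
  have "bounded_linear q"
  proof (rule bounded_linear_intro[where K=K])
    fix \<xi> \<eta> :: 'h and r :: real
    show "q (\<xi> + \<eta>) = q \<xi> + q \<eta>"
      using q[of "\<xi> + \<eta>"] tendsto_add[OF q[of \<xi>] q[of \<eta>]]
      by (auto simp: blinfun.add_right intro: LIMSEQ_unique)
    show "q (r *\<^sub>R \<xi>) = r *\<^sub>R q \<xi>"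
      using q[of "r *\<^sub>R \<xi>"] tendsto_scaleR[OF tendsto_const q[of \<xi>]]
      by (auto simp: blinfun.scaleR_right intro: LIMSEQ_unique)
    show "norm (q \<xi>) \<le> norm \<xi> * K"
      using bound by (intro LIMSEQ_le_const2[OF tendsto_norm[OF q]]) (auto simp: mult.commute)
  qed
  then have Q: "blinfun_apply (Blinfun q) = q"
    by (rule bounded_linear_Blinfun_apply)
  have "q (c *\<^sub>C \<xi>) = c *\<^sub>C q \<xi>" for c \<xi>
  proof -
    have "blinfun_apply (P n) (c *\<^sub>C \<xi>) = c *\<^sub>C blinfun_apply (P n) \<xi>" for n
      using P[of n] by (simp add: commutant_def bounded_ops_def)
    then show ?thesis
      using q[of "c *\<^sub>C \<xi>"] bounded_linear.tendsto[OF bounded_linear_scaleC q[of \<xi>], of c]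
      by (auto intro: LIMSEQ_unique)
  qed
  then have "Blinfun q \<in> bounded_ops"
    by (simp add: bounded_ops_def Q)
  moreover have "Blinfun q o\<^sub>L A = A o\<^sub>L Blinfun q" if "A \<in> S" for A
  proof (rule blinfun_eqI, simp add: Q)
    fix \<xi>
    have "blinfun_apply (P n) (blinfun_apply A \<xi>) = blinfun_apply A (blinfun_apply (P n) \<xi>)" for n
      using P[of n] that by (metis (mono_tags, lifting) blinfun_apply_blinfun_compose commutant_def mem_Collect_eq)
    then show "q (blinfun_apply A \<xi>) = blinfun_apply A (q \<xi>)"
      using q[of "blinfun_apply A \<xi>"] blinfun.tendsto[OF tendsto_const q[of \<xi>], of A]
      by (auto intro: LIMSEQ_unique)
  qed
  ultimately have "Blinfun q \<in> commutant S" by (simp add: commutant_def)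
  then show thesis using q that by (simp add: Q)
qed

lemma
  assumes "von_neumann_algebra N"
  shows vN_id: "id_blinfun \<in> N"
    and vN_comp: "S \<in> N \<Longrightarrow> T \<in> N \<Longrightarrow> S o\<^sub>L T \<in> N"
    and vN_zero: "0 \<in> N"
    and vN_sum: "(\<And>k. k \<in> K \<Longrightarrow> f k \<in> N) \<Longrightarrow> (\<Sum>k\<in>K. f k) \<in> N"
    and vN_scaleC: "T \<in> N \<Longrightarrow> scaleC_op c T \<in> N"
proof -
  have N: "N = commutant (commutant N)"
    using assms by (simp add: von_neumann_algebra_def)
  show "id_blinfun \<in> N" "S \<in> N \<Longrightarrow> T \<in> N \<Longrightarrow> S o\<^sub>L T \<in> N" "0 \<in> N"
    "(\<And>k. k \<in> K \<Longrightarrow> f k \<in> N) \<Longrightarrow> (\<Sum>k\<in>K. f k) \<in> N"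
    by (subst N, (intro commutant_id commutant_comp commutant_zero commutant_sum)?,
        (simp_all flip: N)?)+
  have "commutant N \<subseteq> bounded_ops" by (auto simp: commutant_def)
  then show "scaleC_op c T \<in> N" if "T \<in> N"
    using that commutant_scaleC N by metis
qed

section \<open>Increasing sequences of projections\<close>

lemma cinner_sum_right: "cinner \<xi> (\<Sum>k\<in>K. f k) = (\<Sum>k\<in>K. cinner \<xi> (f k))"
proof -
  have "cinner \<xi> 0 = 0" using cinner_add_right[of \<xi> 0 0] by simp
  then show ?thesis
    by (induction K rule: infinite_finite_induct) (simp_all add: cinner_add_right)
qed

lemma cinner_sum_left: "cinner (\<Sum>k\<in>K. f k) \<xi> = (\<Sum>k\<in>K. cinner (f k) \<xi>)"
  by (subst cinner_commute) (simp add: cinner_sum_right flip: cinner_commute)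

text \<open>For \<open>m \<le> n\<close> the vectors \<open>P m \<xi>\<close> and \<open>P n \<xi> - P m \<xi>\<close> are orthogonal, so
  \<open>\<parallel>P n \<xi> - P m \<xi>\<parallel>\<^sup>2 = \<parallel>P n \<xi>\<parallel>\<^sup>2 - \<parallel>P m \<xi>\<parallel>\<^sup>2\<close>. Thus the squared norms increase and are bounded by
  \<open>\<parallel>\<xi>\<parallel>\<^sup>2\<close>, and their being Cauchy makes the vectors Cauchy.\<close>

lemma increasing_projections:
  fixes P :: "nat \<Rightarrow> 'h::chilbert_space \<Rightarrow>\<^sub>L 'h"
  assumes P: "\<And>n. P n \<in> bounded_ops" and adj: "\<And>n. adj (P n) = P n"
    and mono: "\<And>m n. m \<le> n \<Longrightarrow> P n o\<^sub>L P m = P m"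
  shows "norm (blinfun_apply (P n) \<xi>) \<le> norm \<xi>"
    and "convergent (\<lambda>n. blinfun_apply (P n) \<xi>)"
proof -
  have inner_P: "inner (blinfun_apply (P n) \<xi>) (blinfun_apply (P m) \<xi>) = inner \<xi> (blinfun_apply (P m) \<xi>)"
    if "m \<le> n" for m n
  proof -
    have "cinner (blinfun_apply (P n) \<xi>) (blinfun_apply (P m) \<xi>) = cinner \<xi> (blinfun_apply (P n o\<^sub>L P m) \<xi>)"
      using cinner_adj[OF P, of n \<xi>] by (simp add: adj)
    then show ?thesis unfolding mono[OF that] by (simp flip: Re_cinner)
  qed
  define a where "a n = (norm (blinfun_apply (P n) \<xi>))\<^sup>2" for n
  have a: "a n = inner \<xi> (blinfun_apply (P n) \<xi>)" for n
    using inner_P[of n n] by (simp add: a_def power2_norm_eq_inner)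
  have diff: "(norm (blinfun_apply (P n) \<xi> - blinfun_apply (P m) \<xi>))\<^sup>2 = a n - a m" if "m \<le> n" for m n
    using inner_P[OF that] a[of m]
    by (simp add: a_def power2_norm_eq_inner inner_diff_left inner_diff_right inner_commute)
  show contr: "norm (blinfun_apply (P n) \<xi>) \<le> norm \<xi>" for n
  proof -
    have "norm (blinfun_apply (P n) \<xi>) * norm (blinfun_apply (P n) \<xi>)
        \<le> norm \<xi> * norm (blinfun_apply (P n) \<xi>)"
      using norm_cauchy_schwarz[of \<xi> "blinfun_apply (P n) \<xi>"] a[of n]
      by (simp add: a_def power2_eq_square)
    then show ?thesis
      by (metis mult_right_le_imp_le norm_ge_zero order_le_less)
  qed
  have "incseq a"
  proof (rule incseq_SucI)
    show "a n \<le> a (Suc n)" for n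
      using diff[of n "Suc n"] zero_le_power2[of "norm (blinfun_apply (P (Suc n)) \<xi> - blinfun_apply (P n) \<xi>)"]
      by simp
  qed
  moreover have "a n \<le> (norm \<xi>)\<^sup>2" for n
    unfolding a_def using contr by (intro power_mono) auto
  ultimately have "Cauchy a"
    using incseq_convergent LIMSEQ_imp_Cauchy by (metis (no_types, lifting))
  have "Cauchy (\<lambda>n. blinfun_apply (P n) \<xi>)"
  proof (rule metric_CauchyI)
    fix e :: real assume e: "e > 0"
    then obtain N where N: "\<And>m n. m \<ge> N \<Longrightarrow> n \<ge> N \<Longrightarrow> dist (a m) (a n) < e\<^sup>2"
      using metric_CauchyD[OF \<open>Cauchy a\<close>, of "e\<^sup>2"] by auto
    have "norm (blinfun_apply (P n) \<xi> - blinfun_apply (P m) \<xi>) < e" if "m \<ge> N" "n \<ge> m" for m n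
    proof (rule power2_less_imp_less)
      show "(norm (blinfun_apply (P n) \<xi> - blinfun_apply (P m) \<xi>))\<^sup>2 < e\<^sup>2"
        using N[of n m] that unfolding diff[OF that(2)] by (simp add: dist_real_def)
    qed (use e in simp)
    then show "\<exists>N. \<forall>m\<ge>N. \<forall>n\<ge>N. dist (blinfun_apply (P m) \<xi>) (blinfun_apply (P n) \<xi>) < e"
      by (metis dist_norm dist_commute nle_le)
  qed
  then show "convergent (\<lambda>n. blinfun_apply (P n) \<xi>)"
    by (rule Cauchy_convergent)
qed

section \<open>Matrices and finite module sums\<close>

lemma mat_adjoint_one: "mat_adjoint (1\<^sub>m k :: complex mat) = 1\<^sub>m k"
  by (auto simp: mat_adjoint_def mat_of_rows_def)

lemma mat_adjoint_zero: "mat_adjoint (0\<^sub>m k k :: complex mat) = 0\<^sub>m k k"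
  by (auto simp: mat_adjoint_def mat_of_rows_def)

text \<open>By Cauchy-Schwarz the squared Hilbert-Schmidt norm is such a bound. It shows that a single
  block, extended by zero, belongs to the direct sum.\<close>

lemma matrix_bounded:
  fixes A :: "complex mat"
  assumes A: "A \<in> carrier_mat d d"
  shows "\<exists>C\<ge>0. \<forall>v\<in>carrier_vec d.
    (\<Sum>k<d. (cmod (vec_index (mult_mat_vec A v) k))\<^sup>2) \<le> C * (\<Sum>k<d. (cmod (vec_index v k))\<^sup>2)"
proof -
  let ?C = "\<Sum>k<d. \<Sum>l<d. (cmod (A $$ (k, l)))\<^sup>2"
  have "(\<Sum>k<d. (cmod (vec_index (mult_mat_vec A v) k))\<^sup>2) \<le> ?C * (\<Sum>k<d. (cmod (vec_index v k))\<^sup>2)"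
    if v: "v \<in> carrier_vec d" for v
  proof -
    have "(cmod (vec_index (mult_mat_vec A v) k))\<^sup>2
        \<le> (\<Sum>l<d. (cmod (A $$ (k, l)))\<^sup>2) * (\<Sum>l<d. (cmod (vec_index v l))\<^sup>2)" if k: "k < d" for k
    proof -
      have "vec_index (mult_mat_vec A v) k = (\<Sum>l<d. A $$ (k, l) * vec_index v l)"
        using A v k by (simp add: scalar_prod_def atLeast0LessThan)
      then have "cmod (vec_index (mult_mat_vec A v) k)
          \<le> (\<Sum>l<d. cmod (A $$ (k, l)) * cmod (vec_index v l))"
        by (simp add: sum_norm_le norm_mult)
      then have "(cmod (vec_index (mult_mat_vec A v) k))\<^sup>2
          \<le> (\<Sum>l<d. cmod (A $$ (k, l)) * cmod (vec_index v l))\<^sup>2"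
        by (intro power_mono) auto
      also note Cauchy_Schwarz_ineq_sum
      finally show ?thesis .
    qed
    then show ?thesis
      unfolding sum_distrib_right by (intro sum_mono) (auto simp: sum_distrib_right)
  qed
  moreover have "0 \<le> ?C" by (intro sum_nonneg) auto
  ultimately show ?thesis by blast
qed

definition matrix_unit :: "nat \<Rightarrow> nat \<times> nat \<Rightarrow> complex mat" where
  "matrix_unit d kl = mat d d (\<lambda>rs. if rs = kl then 1 else 0)"

lemma matrix_unit_carrier [simp]: "matrix_unit d kl \<in> carrier_mat d d"
  by (simp add: matrix_unit_def)

text \<open>A module sum has one coefficient for each element of \<open>X\<close>, whereas the families that occur below
  are indexed and may repeat an operator; the coefficients of equal operators are added up.\<close>

lemma sum_in_right_module_sum:
  assumes "von_neumann_algebra B" "finite K" "finite X" "g ` K \<subseteq> X" "\<And>k. k \<in> K \<Longrightarrow> a k \<in> B"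
  shows "(\<Sum>k\<in>K. g k o\<^sub>L a k) \<in> right_module_sum X B"
proof -
  let ?f = "\<lambda>y. \<Sum>k\<in>{k\<in>K. g k = y}. a k"
  have "(\<Sum>k\<in>K. g k o\<^sub>L a k) = (\<Sum>y\<in>X. \<Sum>k\<in>{k\<in>K. g k = y}. g k o\<^sub>L a k)"
    by (rule sum.group[symmetric]) (use assms in auto)
  also have "\<dots> = (\<Sum>y\<in>X. y o\<^sub>L ?f y)"
    by (auto intro!: sum.cong simp: bounded_bilinear.sum_right[OF bounded_bilinear_blinfun_compose])
  finally have eq: "(\<Sum>k\<in>K. g k o\<^sub>L a k) = (\<Sum>y\<in>X. y o\<^sub>L ?f y)" .
  have mem: "\<forall>y\<in>X. ?f y \<in> B"
    using assms(5) by (auto intro!: vN_sum[OF assms(1)])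
  show ?thesis
    unfolding right_module_sum_def by (intro CollectI exI[of _ ?f] conjI eq mem)
qed

lemma sum_in_left_module_sum:
  assumes "von_neumann_algebra B" "finite K" "finite X" "g ` K \<subseteq> X" "\<And>k. k \<in> K \<Longrightarrow> a k \<in> B"
  shows "(\<Sum>k\<in>K. a k o\<^sub>L g k) \<in> left_module_sum B X"
proof -
  let ?f = "\<lambda>y. \<Sum>k\<in>{k\<in>K. g k = y}. a k"
  have "(\<Sum>k\<in>K. a k o\<^sub>L g k) = (\<Sum>y\<in>X. \<Sum>k\<in>{k\<in>K. g k = y}. a k o\<^sub>L g k)"
    by (rule sum.group[symmetric]) (use assms in auto)
  also have "\<dots> = (\<Sum>y\<in>X. ?f y o\<^sub>L y)"
    by (auto intro!: sum.cong simp: bounded_bilinear.sum_left[OF bounded_bilinear_blinfun_compose])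
  finally have eq: "(\<Sum>k\<in>K. a k o\<^sub>L g k) = (\<Sum>y\<in>X. ?f y o\<^sub>L y)" .
  have mem: "\<forall>y\<in>X. ?f y \<in> B"
    using assms(5) by (auto intro!: vN_sum[OF assms(1)])
  show ?thesis
    unfolding left_module_sum_def by (intro CollectI exI[of _ ?f] conjI eq mem)
qed

section \<open>Decomposition into matrix blocks\<close>

locale block_decomposition =
  fixes B :: "('h::chilbert_space \<Rightarrow>\<^sub>L 'h) set" and I :: "nat set" and n :: "nat \<Rightarrow> nat"
    and \<phi> :: "('h \<Rightarrow>\<^sub>L 'h) \<Rightarrow> nat \<Rightarrow> complex mat"
  assumes vN: "von_neumann_algebra B"
    and iso: "matrix_star_isomorphism B I n \<phi>"
begin

lemmas B_id = vN_id[OF vN]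
  and B_comp = vN_comp[OF vN]
  and B_zero = vN_zero[OF vN]
  and B_sum = vN_sum[OF vN]
  and B_scaleC = vN_scaleC[OF vN]

lemma B_bounded: "T \<in> B \<Longrightarrow> T \<in> bounded_ops"
  using vN by (auto simp: von_neumann_algebra_def)

lemma B_adj: "T \<in> B \<Longrightarrow> adj T \<in> B"
  using vN by (simp add: von_neumann_algebra_def)

lemma \<phi>_mem: "T \<in> B \<Longrightarrow> \<phi> T \<in> matrix_direct_sum I n"
  using iso by (auto simp: matrix_star_isomorphism_def bij_betw_def)

lemma \<phi>_carrier: "T \<in> B \<Longrightarrow> i \<in> I \<Longrightarrow> \<phi> T i \<in> carrier_mat (n i) (n i)"
  using \<phi>_mem[of T] by (auto simp: matrix_direct_sum_def)

lemma \<phi>_add: "S \<in> B \<Longrightarrow> T \<in> B \<Longrightarrow> i \<in> I \<Longrightarrow> \<phi> (S + T) i = \<phi> S i + \<phi> T i"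
  and \<phi>_scaleC: "T \<in> B \<Longrightarrow> i \<in> I \<Longrightarrow> \<phi> (scaleC_op c T) i = c \<cdot>\<^sub>m \<phi> T i"
  and \<phi>_comp: "S \<in> B \<Longrightarrow> T \<in> B \<Longrightarrow> i \<in> I \<Longrightarrow> \<phi> (S o\<^sub>L T) i = \<phi> S i * \<phi> T i"
  and \<phi>_adj: "T \<in> B \<Longrightarrow> i \<in> I \<Longrightarrow> \<phi> (adj T) i = mat_adjoint (\<phi> T i)"
  using iso by (auto simp: matrix_star_isomorphism_def)

lemma eq_if_components_eq:
  assumes "S \<in> B" "T \<in> B" "\<And>i. i \<in> I \<Longrightarrow> \<phi> S i = \<phi> T i"
  shows "S = T"
proof -
  have "\<phi> S = \<phi> T"
    using \<phi>_mem[OF assms(1)] \<phi>_mem[OF assms(2)] assms(3)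
    by (auto simp: matrix_direct_sum_def intro: PiE_ext)
  then show ?thesis
    using iso assms by (auto simp: matrix_star_isomorphism_def bij_betw_def dest: inj_onD)
qed

lemma \<phi>_zero: "i \<in> I \<Longrightarrow> \<phi> 0 i = 0\<^sub>m (n i) (n i)"
proof -
  assume i: "i \<in> I"
  have "scaleC_op 0 0 = (0 :: 'h \<Rightarrow>\<^sub>L 'h)"
    by (rule blinfun_eqI) (simp add: scaleC_zero_right)
  then have "\<phi> 0 i = 0 \<cdot>\<^sub>m \<phi> 0 i"
    using \<phi>_scaleC[OF B_zero i, of 0] by simp
  moreover have "0 \<cdot>\<^sub>m A = 0\<^sub>m d d" if "A \<in> carrier_mat d d" for A :: "complex mat" and d
    using that by auto
  ultimately show ?thesis using \<phi>_carrier[OF B_zero i] by simp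
qed

text \<open>Entrywise, because matrices of unspecified size do not form a monoid over which sums could be
  taken.\<close>

lemma \<phi>_sum_entry:
  assumes "\<And>k. k \<in> K \<Longrightarrow> f k \<in> B" "i \<in> I" "r < n i" "s < n i"
  shows "\<phi> (\<Sum>k\<in>K. f k) i $$ (r, s) = (\<Sum>k\<in>K. \<phi> (f k) i $$ (r, s))"
  using assms
proof (induction K rule: infinite_finite_induct)
  case (insert k K)
  then show ?case
    using \<phi>_carrier[of "sum f K" i] B_sum[of K f] by (simp add: \<phi>_add)
qed (auto simp: \<phi>_zero)

definition block :: "nat \<Rightarrow> complex mat \<Rightarrow> ('h \<Rightarrow>\<^sub>L 'h)" where
  "block i A = inv_into B \<phi> (\<lambda>j\<in>I. if j = i then A else 0\<^sub>m (n j) (n j))"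

lemma block:
  assumes i: "i \<in> I" and A: "A \<in> carrier_mat (n i) (n i)"
  shows block_B: "block i A \<in> B"
    and \<phi>_block: "j \<in> I \<Longrightarrow> \<phi> (block i A) j = (if j = i then A else 0\<^sub>m (n j) (n j))"
proof -
  let ?a = "\<lambda>j\<in>I. if j = i then A else 0\<^sub>m (n j) (n j)"
  obtain C where C: "\<And>v. v \<in> carrier_vec (n i) \<Longrightarrow>
      (\<Sum>k<n i. (cmod (vec_index (mult_mat_vec A v) k))\<^sup>2) \<le> C * (\<Sum>k<n i. (cmod (vec_index v k))\<^sup>2)"
    "0 \<le> C"
    using matrix_bounded[OF A] by blast
  have "?a \<in> matrix_direct_sum I n"
    unfolding matrix_direct_sum_def
    using A C by (auto simp: sum_nonneg intro!: exI[of _ C])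
  then have a: "?a \<in> \<phi> ` B"
    using iso by (simp add: matrix_star_isomorphism_def bij_betw_def)
  show "block i A \<in> B" using a unfolding block_def by (rule inv_into_into)
  show "\<phi> (block i A) j = (if j = i then A else 0\<^sub>m (n j) (n j))" if "j \<in> I"
    using f_inv_into_f[OF a] that by (simp add: block_def)
qed

text \<open>The elements concentrated in one summand form a two-sided ideal.\<close>

lemma comp_block:
  assumes i: "i \<in> I" and A: "A \<in> carrier_mat (n i) (n i)" and b: "b \<in> B"
  shows "b o\<^sub>L block i A = block i (\<phi> b i * A)"
    and "block i A o\<^sub>L b = block i (A * \<phi> b i)"
proof -
  have c: "\<phi> b i * A \<in> carrier_mat (n i) (n i)" "A * \<phi> b i \<in> carrier_mat (n i) (n i)"
    using \<phi>_carrier[OF b i] A by auto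
  show "b o\<^sub>L block i A = block i (\<phi> b i * A)"
    by (rule eq_if_components_eq)
       (use \<phi>_carrier[OF b] in \<open>auto simp: left_mult_zero_mat[OF \<phi>_carrier[OF b]] right_mult_zero_mat[OF \<phi>_carrier[OF b]] block_B[OF i A] block_B[OF i c(1)] B_comp b \<phi>_comp \<phi>_block[OF i A] \<phi>_block[OF i c(1)]\<close>)
  show "block i A o\<^sub>L b = block i (A * \<phi> b i)"
    by (rule eq_if_components_eq)
       (use \<phi>_carrier[OF b] in \<open>auto simp: left_mult_zero_mat[OF \<phi>_carrier[OF b]] right_mult_zero_mat[OF \<phi>_carrier[OF b]] block_B[OF i A] block_B[OF i c(2)] B_comp b \<phi>_comp \<phi>_block[OF i A] \<phi>_block[OF i c(2)]\<close>)
qed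

text \<open>This is the finite-dimensionality of a single summand.\<close>

lemma block_expansion:
  assumes i: "i \<in> I" and A: "A \<in> carrier_mat (n i) (n i)"
  shows "block i A = (\<Sum>kl\<in>{..<n i} \<times> {..<n i}. scaleC_op (A $$ kl) (block i (matrix_unit (n i) kl)))"
proof (rule eq_if_components_eq)
  let ?f = "\<lambda>kl. scaleC_op (A $$ kl) (block i (matrix_unit (n i) kl))"
  let ?K = "{..<n i} \<times> {..<n i}"
  have f: "?f kl \<in> B" for kl by (intro B_scaleC block_B i matrix_unit_carrier)
  show "block i A \<in> B" by (rule block_B[OF i A])
  show s: "sum ?f ?K \<in> B" by (intro B_sum f)
  fix j assume j: "j \<in> I"
  show "\<phi> (block i A) j = \<phi> (sum ?f ?K) j"
  proof (rule eq_matI)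
    fix r s assume "r < dim_row (\<phi> (sum ?f ?K) j)" "s < dim_col (\<phi> (sum ?f ?K) j)"
    then have rs: "r < n j" "s < n j" using \<phi>_carrier[OF s j] by auto
    have entry: "\<phi> (?f kl) j $$ (r, s) = (if j = i \<and> (r, s) = kl then A $$ kl else 0)" for kl
      using rs i j by (auto simp: \<phi>_scaleC block_B \<phi>_block matrix_unit_def)
    have "\<phi> (sum ?f ?K) j $$ (r, s) = (\<Sum>kl\<in>?K. if j = i \<and> (r, s) = kl then A $$ kl else 0)"
      using \<phi>_sum_entry[OF f j rs, where K="?K"] by (simp only: entry)
    also have "\<dots> = \<phi> (block i A) j $$ (r, s)"
      using rs j by (auto simp: \<phi>_block[OF i A])
    finally show "\<phi> (block i A) j $$ (r, s) = \<phi> (sum ?f ?K) j $$ (r, s)" ..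
  qed (use \<phi>_carrier[OF s j] \<phi>_carrier[OF block_B[OF i A] j] in auto)
qed

definition central_proj :: "nat \<Rightarrow> ('h \<Rightarrow>\<^sub>L 'h)" where
  "central_proj i = block i (1\<^sub>m (n i))"

lemma central_proj_B: "i \<in> I \<Longrightarrow> central_proj i \<in> B"
  by (simp add: central_proj_def block_B)

lemma \<phi>_central_proj:
  "i \<in> I \<Longrightarrow> j \<in> I \<Longrightarrow> \<phi> (central_proj i) j = (if j = i then 1\<^sub>m (n j) else 0\<^sub>m (n j) (n j))"
  by (simp add: central_proj_def \<phi>_block)

lemma adj_central_proj: "i \<in> I \<Longrightarrow> adj (central_proj i) = central_proj i"
  by (rule eq_if_components_eq)
     (simp_all add: central_proj_B B_adj \<phi>_adj \<phi>_central_proj mat_adjoint_one mat_adjoint_zero)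

lemma central_proj_orthogonal:
  "i \<in> I \<Longrightarrow> j \<in> I \<Longrightarrow> central_proj i o\<^sub>L central_proj j = (if i = j then central_proj i else 0)"
  by (rule eq_if_components_eq)
     (auto simp: central_proj_B B_comp B_zero \<phi>_comp \<phi>_central_proj \<phi>_zero)

section \<open>The central projections sum to the identity\<close>

definition partial_unit :: "nat \<Rightarrow> ('h \<Rightarrow>\<^sub>L 'h)" where
  "partial_unit N = (\<Sum>i\<in>I \<inter> {..<N}. central_proj i)"

lemma partial_unit_B: "partial_unit N \<in> B"
  unfolding partial_unit_def by (intro B_sum central_proj_B) auto

text \<open>The strong limit exists by monotonicity and belongs to the bicommutant \<open>B\<close>. It absorbs every
  central projection, so it has the same components as the identity operator.\<close>

lemma partial_unit_tendsto: "(\<lambda>N. blinfun_apply (partial_unit N) \<xi>) \<longlonglongrightarrow> \<xi>"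
proof -
  have absorb: "partial_unit N o\<^sub>L central_proj i = central_proj i" if i: "i \<in> I" "i < N" for N i
  proof -
    have "partial_unit N o\<^sub>L central_proj i = (\<Sum>j\<in>I \<inter> {..<N}. if j = i then central_proj i else 0)"
      unfolding partial_unit_def bounded_bilinear.sum_left[OF bounded_bilinear_blinfun_compose]
      using i by (auto intro!: sum.cong simp: central_proj_orthogonal)
    then show ?thesis using i by simp
  qed
  have mono: "partial_unit N o\<^sub>L partial_unit M = partial_unit M" if "M \<le> N" for M N
  proof -
    have "partial_unit N o\<^sub>L partial_unit M = (\<Sum>i\<in>I \<inter> {..<M}. partial_unit N o\<^sub>L central_proj i)"
      unfolding partial_unit_def[of M] by (rule bounded_bilinear.sum_right[OF bounded_bilinear_blinfun_compose])
    also have "\<dots> = partial_unit M"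
      using that by (auto intro!: sum.cong simp: partial_unit_def[of M] absorb)
    finally show ?thesis .
  qed
  have adj: "adj (partial_unit N) = partial_unit N" for N
  proof (rule adj_unique)
    fix \<xi> \<eta>
    have "cinner (blinfun_apply (central_proj i) \<xi>) \<eta> = cinner \<xi> (blinfun_apply (central_proj i) \<eta>)"
      if "i \<in> I" for i
      using cinner_adj[OF B_bounded[OF central_proj_B[OF that]], of \<xi> \<eta>]
      by (simp add: adj_central_proj that)
    then show "cinner (blinfun_apply (partial_unit N) \<xi>) \<eta> = cinner \<xi> (blinfun_apply (partial_unit N) \<eta>)"
      by (simp add: partial_unit_def blinfun.sum_left cinner_sum_left cinner_sum_right)
  qed
  have proj: "norm (blinfun_apply (partial_unit N) \<xi>) \<le> 1 * norm \<xi>"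
    "convergent (\<lambda>N. blinfun_apply (partial_unit N) \<xi>)" for N \<xi>
    using increasing_projections[of partial_unit, OF B_bounded[OF partial_unit_B] adj mono] by simp_all
  have in_bicommutant: "partial_unit N \<in> commutant (commutant B)" for N
    using vN partial_unit_B by (simp add: von_neumann_algebra_def)
  obtain Q where "Q \<in> commutant (commutant B)"
    and Q: "\<And>\<xi>. (\<lambda>N. blinfun_apply (partial_unit N) \<xi>) \<longlonglongrightarrow> blinfun_apply Q \<xi>"
    using commutant_strong_limit[OF in_bicommutant proj] by blast
  then have Q_B: "Q \<in> B"
    using vN by (simp add: von_neumann_algebra_def)
  have Q_central: "Q o\<^sub>L central_proj i = central_proj i" if i: "i \<in> I" for i
  proof (rule blinfun_eqI)
    fix \<xi>
    have "blinfun_apply (partial_unit N) (blinfun_apply (central_proj i) \<xi>)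
        = blinfun_apply (central_proj i) \<xi>" if "Suc i \<le> N" for N
      using absorb[OF i, of N] that by (metis Suc_le_lessD blinfun_apply_blinfun_compose)
    then have "(\<lambda>N. blinfun_apply (partial_unit N) (blinfun_apply (central_proj i) \<xi>))
        \<longlonglongrightarrow> blinfun_apply (central_proj i) \<xi>"
      by (intro tendsto_eventually eventually_sequentiallyI)
    then show "blinfun_apply (Q o\<^sub>L central_proj i) \<xi> = blinfun_apply (central_proj i) \<xi>"
      using Q LIMSEQ_unique by (metis blinfun_apply_blinfun_compose)
  qed
  have component: "\<phi> T i = 1\<^sub>m (n i)" if T: "T \<in> B" "T o\<^sub>L central_proj i = central_proj i" and i: "i \<in> I" for T i
    using \<phi>_comp[OF T(1) central_proj_B[OF i] i] \<phi>_carrier[OF T(1) i] T(2) i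
    by (simp add: \<phi>_central_proj)
  have "id_blinfun o\<^sub>L T = T" for T :: "'h \<Rightarrow>\<^sub>L 'h"
    by (rule blinfun_eqI) simp
  then have "Q = id_blinfun"
    by (intro eq_if_components_eq Q_B B_id) (simp add: component Q_B B_id Q_central)
  then show ?thesis using Q[of \<xi>] by simp
qed

section \<open>Corners are quasi-normalizers\<close>

text \<open>Multiplying \<open>z\<^sub>i\<close> on the left by \<open>b \<in> B\<close> gives a linear combination of matrix units of the
  \<open>i\<close>-th summand. The scalars of this combination, viewed as elements of \<open>B\<close>, serve as the module
  coefficients and can be moved to the other side because they are central. The same
  argument in the \<open>j\<close>-th summand applies to multiplication by \<open>b\<close> on the right.\<close>

lemma quasi_normalizer_corner:
  assumes M: "von_neumann_algebra M" and BM: "B \<subseteq> M" and x: "x \<in> M" and i: "i \<in> I" and j: "j \<in> I"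
  shows "central_proj i o\<^sub>L x o\<^sub>L central_proj j \<in> quasi_normalizers M B"
proof -
  let ?z = "central_proj i o\<^sub>L x o\<^sub>L central_proj j"
  let ?K = "\<lambda>i. {..<n i} \<times> {..<n i}"
  let ?e = "\<lambda>i kl. block i (matrix_unit (n i) kl)"
  let ?g = "\<lambda>kl. ?e i kl o\<^sub>L x o\<^sub>L central_proj j"
  let ?h = "\<lambda>kl. central_proj i o\<^sub>L x o\<^sub>L ?e j kl"
  let ?X = "?g ` ?K i \<union> ?h ` ?K j"
  have e: "?e i kl \<in> B" "?e j kl \<in> B" for kl
    using i j by (simp_all add: block_B)
  have g: "?g kl \<in> M" and h: "?h kl \<in> M" for kl
    by (intro vN_comp[OF M] x e[THEN subsetD[OF BM]]
        i[THEN central_proj_B, THEN subsetD[OF BM]] j[THEN central_proj_B, THEN subsetD[OF BM]])+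
  have scalar: "scaleC_op c id_blinfun \<in> B" for c
    by (intro B_scaleC B_id)
  have "b o\<^sub>L ?z \<in> right_module_sum ?X B" if b: "b \<in> B" for b
  proof -
    have "b o\<^sub>L central_proj i = (\<Sum>kl\<in>?K i. scaleC_op (\<phi> b i $$ kl) (?e i kl))"
      unfolding central_proj_def using comp_block(1)[OF i _ b] block_expansion[OF i] \<phi>_carrier[OF b i] by simp
    then have "b o\<^sub>L ?z = (\<Sum>kl\<in>?K i. scaleC_op (\<phi> b i $$ kl) (?e i kl)) o\<^sub>L x o\<^sub>L central_proj j"
      by (simp flip: blinfun_compose_assoc)
    also have "\<dots> = (\<Sum>kl\<in>?K i. ?g kl o\<^sub>L scaleC_op (\<phi> b i $$ kl) id_blinfun)"
    proof (rule blinfun_eqI)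
      have lin: "blinfun_apply T (c *\<^sub>C \<xi>) = c *\<^sub>C blinfun_apply T \<xi>" if "T \<in> M" for T c \<xi>
        using that M by (auto simp: von_neumann_algebra_def bounded_ops_def)
      show "blinfun_apply ((\<Sum>kl\<in>?K i. scaleC_op (\<phi> b i $$ kl) (?e i kl)) o\<^sub>L x o\<^sub>L central_proj j) \<xi>
          = blinfun_apply (\<Sum>kl\<in>?K i. ?g kl o\<^sub>L scaleC_op (\<phi> b i $$ kl) id_blinfun) \<xi>" for \<xi>
        using lin[OF g] by (simp add: blinfun.sum_left)
    qed
    also have "\<dots> \<in> right_module_sum ?X B"
      by (rule sum_in_right_module_sum[OF vN]) (auto intro: scalar)
    finally show ?thesis .
  qed
  moreover have "?z o\<^sub>L b \<in> left_module_sum B ?X" if b: "b \<in> B" for b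
  proof -
    have "central_proj j o\<^sub>L b = (\<Sum>kl\<in>?K j. scaleC_op (\<phi> b j $$ kl) (?e j kl))"
      unfolding central_proj_def using comp_block(2)[OF j _ b] block_expansion[OF j] \<phi>_carrier[OF b j] by simp
    then have "?z o\<^sub>L b = central_proj i o\<^sub>L x o\<^sub>L (\<Sum>kl\<in>?K j. scaleC_op (\<phi> b j $$ kl) (?e j kl))"
      by (simp add: blinfun_compose_assoc)
    also have "\<dots> = (\<Sum>kl\<in>?K j. scaleC_op (\<phi> b j $$ kl) id_blinfun o\<^sub>L ?h kl)"
    proof (rule blinfun_eqI)
      have zx: "central_proj i o\<^sub>L x \<in> M"
        using x BM central_proj_B[OF i] by (auto intro!: vN_comp[OF M])
      then have lin: "blinfun_apply (central_proj i o\<^sub>L x) (c *\<^sub>C \<xi>)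
          = c *\<^sub>C blinfun_apply (central_proj i o\<^sub>L x) \<xi>" for c \<xi>
        using M unfolding von_neumann_algebra_def bounded_ops_def by blast
      show "blinfun_apply (central_proj i o\<^sub>L x o\<^sub>L (\<Sum>kl\<in>?K j. scaleC_op (\<phi> b j $$ kl) (?e j kl))) \<xi>
          = blinfun_apply (\<Sum>kl\<in>?K j. scaleC_op (\<phi> b j $$ kl) id_blinfun o\<^sub>L ?h kl) \<xi>" for \<xi>
        using lin by (simp add: blinfun.sum_left blinfun.sum_right)
    qed
    also have "\<dots> \<in> left_module_sum B ?X"
      by (rule sum_in_left_module_sum[OF vN]) (auto intro: scalar)
    finally show ?thesis .
  qed
  moreover have "?z \<in> M"
    using BM x central_proj_B[OF i] central_proj_B[OF j]
    by (auto intro!: vN_comp[OF M])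
  moreover have "finite ?X" "?X \<subseteq> M" using g h by auto
  ultimately show ?thesis
    unfolding quasi_normalizers_def by blast
qed

text \<open>If \<open>T\<close> commutes with all corners of \<open>x\<close>, then it commutes with \<open>P N \<circ> x \<circ> P N'\<close> for the partial
  sums \<open>P\<close> of the central projections. Letting first \<open>N\<close> and then \<open>N'\<close> tend to infinity uses
  strong convergence for one fixed vector at a time.\<close>

lemma commutant_quasi_normalizers:
  assumes M: "von_neumann_algebra M" and BM: "B \<subseteq> M"
  shows "commutant (quasi_normalizers M B) \<subseteq> commutant M"
proof
  fix T assume T: "T \<in> commutant (quasi_normalizers M B)"
  have "blinfun_apply T (blinfun_apply x \<xi>) = blinfun_apply x (blinfun_apply T \<xi>)" if x: "x \<in> M" for x \<xi>
  proof -
    let ?P = "\<lambda>N \<xi>. blinfun_apply (partial_unit N) \<xi>"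
    have corner: "blinfun_apply T (?P N (blinfun_apply x (?P N' \<xi>)))
        = ?P N (blinfun_apply x (?P N' (blinfun_apply T \<xi>)))" for N N'
    proof -
      have "blinfun_apply T (blinfun_apply (central_proj i) (blinfun_apply x (blinfun_apply (central_proj j) \<xi>)))
          = blinfun_apply (central_proj i) (blinfun_apply x (blinfun_apply (central_proj j) (blinfun_apply T \<xi>)))"
        if "i \<in> I" "j \<in> I" for i j
      proof -
        have "T o\<^sub>L (central_proj i o\<^sub>L x o\<^sub>L central_proj j) = (central_proj i o\<^sub>L x o\<^sub>L central_proj j) o\<^sub>L T"
          using T quasi_normalizer_corner[OF M BM x that] by (simp add: commutant_def)
        from arg_cong[OF this, of "\<lambda>S. blinfun_apply S \<xi>"] show ?thesis by simp
      qed
      then show ?thesis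
        by (simp add: partial_unit_def blinfun.sum_left blinfun.sum_right)
    qed
    have "blinfun_apply T (blinfun_apply x (?P N' \<xi>)) = blinfun_apply x (?P N' (blinfun_apply T \<xi>))" for N'
      using LIMSEQ_unique[OF blinfun.tendsto[OF tendsto_const partial_unit_tendsto], of T "blinfun_apply x (?P N' \<xi>)"]
        partial_unit_tendsto[of "blinfun_apply x (?P N' (blinfun_apply T \<xi>))"]
      by (simp add: corner)
    moreover have "(\<lambda>N. blinfun_apply T (blinfun_apply x (?P N \<xi>))) \<longlonglongrightarrow> blinfun_apply T (blinfun_apply x \<xi>)"
      "(\<lambda>N. blinfun_apply x (?P N (blinfun_apply T \<xi>))) \<longlonglongrightarrow> blinfun_apply x (blinfun_apply T \<xi>)"
      by (intro blinfun.tendsto tendsto_const partial_unit_tendsto)+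
    ultimately show ?thesis by (simp add: LIMSEQ_unique)
  qed
  then show "T \<in> commutant M"
    using T by (auto simp: commutant_def intro!: blinfun_eqI)
qed

end

theorem proposition4p4:
  fixes M B :: "('h::chilbert_space \<Rightarrow>\<^sub>L 'h) set"
    and \<tau> :: "('h \<Rightarrow>\<^sub>L 'h) \<Rightarrow> complex"
  assumes "finite_vN M"
    and "faithful_normal_trace M \<tau>"
    and "vN_subalgebra B M"
    and "atomic_vN B"
  shows "vN_generated M (one_sided_quasi_normalizers M B)
           = commutant (commutant (quasi_normalizers M B))
       \<and> commutant (commutant (quasi_normalizers M B)) = M"
proof -
  have M: "von_neumann_algebra M" and M_eq: "commutant (commutant M) = M"
    using assms(1) by (auto simp: finite_vN_def von_neumann_algebra_def)
  have BM: "B \<subseteq> M" using assms(3) by (simp add: vN_subalgebra_def)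
  obtain I n \<phi> where "block_decomposition B I n \<phi>"
    using assms(4) unfolding atomic_vN_def block_decomposition_def by blast
  then have M_sub: "M \<subseteq> commutant (commutant (quasi_normalizers M B))"
    using block_decomposition.commutant_quasi_normalizers[OF _ M BM] commutant_antimono M_eq by metis
  have "quasi_normalizers M B \<subseteq> M" by (auto simp: quasi_normalizers_def)
  then have qN: "commutant (commutant (quasi_normalizers M B)) = M"
    using M_sub M_eq by (metis commutant_antimono subset_antisym)
  moreover have "vN_generated M (one_sided_quasi_normalizers M B) = M"
  proof (rule antisym)
    have "vN_subalgebra M M" "one_sided_quasi_normalizers M B \<subseteq> M"
      using M by (auto simp: vN_subalgebra_def one_sided_quasi_normalizers_def)
    then show "vN_generated M (one_sided_quasi_normalizers M B) \<subseteq> M"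
      by (auto simp: vN_generated_def)
    have "M \<subseteq> N" if N: "vN_subalgebra N M" "one_sided_quasi_normalizers M B \<subseteq> N" for N
    proof -
      have "quasi_normalizers M B \<subseteq> one_sided_quasi_normalizers M B"
        by (auto simp: quasi_normalizers_def one_sided_quasi_normalizers_def)
      then have "commutant (commutant (quasi_normalizers M B)) \<subseteq> commutant (commutant N)"
        using N(2) by (intro commutant_antimono) auto
      then show ?thesis
        using N(1) qN by (simp add: vN_subalgebra_def von_neumann_algebra_def)
    qed
    then show "M \<subseteq> vN_generated M (one_sided_quasi_normalizers M B)"
      by (auto simp: vN_generated_def)
  qed
  ultimately show ?thesis by simp
qed

end
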